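(* Let $\mathcal{M}_1$ be the simplicial set with $\mathcal{M}_1(n)$ the set of all metrics $d:[n]\times[n]\to\mathbb{R}_{\ge0}$ on $[n]=\{0,\dots,n\}$, and $(Af)(x,y):=A(f(x),f(y))$ for $f\in\Delta([n],[m])$ and $A\in\mathcal{M}_1(m)$. For a $k$-composable pair $(A,B)\in\mathcal{M}_1(m)\times\mathcal{M}_1(n)$ and $x,z\in[m+n-k]$ put $$(A\circ_k B)(x,z):=\begin{cases}A(x,z)&\text{if }x\le m,\ z\le m,\\ \min\limits_{m-k\le y\le m}\big(A(x,y)+B(y-m+k,z-m+k)\big)&\text{if }x\le m,\ z\ge m-k,\\ \min\limits_{m-k\le y\le m}\big(B(x-m+k,y-m+k)+A(y,z)\big)&\text{if }x\ge m-k,\ z\le m,\\ B(x-m+k,z-m+k)&\text{if }x\ge m-k,\ z\ge m-k,\end{cases}$$ (the values agree where cases overlap). With these definitions, $\mathcal{M}_1$ is a compository.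
   Context: **Metrics.** Here a metric on a set $X$ is a function $d:X\times X\to\mathbb{R}_{\ge0}$ with $d(x,x)=0$, $d(x,z)\le d(x,y)+d(y,z)$ and $d(x,y)=d(y,x)$; non-degeneracy is not required (so these are pseudometrics). The symmetry axiom may equally be dropped throughout. **Simplicial conventions.** $\mathbb{N}$ includes $0$. $\Delta$ is the category of nonempty finite ordinals $[n]=\{0,\dots,n\}$ and order-preserving maps. A simplicial set is a functor $\mathcal{C}:\Delta^{\mathrm{op}}\to\mathbf{Set}$; write $\mathcal{C}(n)=\mathcal{C}([n])$, and for $f:[m]\to[n]$ and $A\in\mathcal{C}(n)$ write $Af:=\mathcal{C}(f)(A)\in\mathcal{C}(m)$. The map $\partial_k:[n-1]\to[n]$ is the injective order-preserving map omitting $k$; $\eta_k:[n+1]\to[n]$ is the surjective order-preserving map hitting $k$ twice. For $k\le n$, $s_k:[k]\to[n]$ is $v\mapsto v$ and $t_k:[k]\to[n]$ is $v\mapsto v+n-k$; the codomain index $n$ is left implicit. **Compositories.** A pair $(A,B)\in\mathcal{C}(m)\times\mathcal{C}(n)$ is $k$-composable ($k\le m,n$) if $At_k=Bs_k$. A compository is a simplicial set $\mathcal{C}$ with an element $A\circ_k B\in\mathcal{C}(m+n-k)$ for every $k\in\mathbb{N}$ and every $k$-composable pair $(A,B)\in\mathcal{C}(m)\times\mathcal{C}(n)$, such that: 1. (Identity) $As_k\circ_k A=A$ and $A\circ_k At_k=A$. And for every $k$-composable $(A,B)\in\mathcal{C}(m)\times\mathcal{C}(n)$: 2. (Back-and-forth)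 $(A\circ_k B)s_{m+i}\circ_{k+i}B=A\circ_k B$ for $0\le i\le n-k$; $A\circ_{k+j}(A\circ_k B)t_{n+j}=A\circ_k B$ for $0\le j\le m-k$. 3. (Degeneracies) $(A\circ_k B)\eta_i=A\eta_i\circ_k B$ for $i\le m-k$; $(A\circ_k B)\eta_i=A\circ_k B\eta_{i-m+k}$ for $i\ge m$; $(A\circ_k B)\eta_i=A\eta_i\circ_{k+1}B\eta_{i-m+k}$ for $m-k\le i\le m$. 4. (Faces) $(A\circ_k B)\partial_i=A\partial_i\circ_k B$ for $i<m-k$; $(A\circ_k B)\partial_i=A\circ_k B\partial_{i-m+k}$ for $i>m$. *)

theory Defs
  imports Complex_Main "HOL-Library.FuncSet"
begin

text \<open>
  The ordinal \<open>[n]\<close> is \<open>{..n}\<close>. A map \<open>[m] \<rightarrow> [n]\<close> is an extensional function, so that equality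
  of morphisms is equality in HOL. Since the (co)domain cannot be read off such a function, all
  operations below carry the relevant dimensions as explicit arguments.
\<close>

definition ord_maps :: "nat \<Rightarrow> nat \<Rightarrow> (nat \<Rightarrow> nat) set" where
  "ord_maps m n = {f \<in> {..m} \<rightarrow>\<^sub>E {..n}. mono_on {..m} f}"

text \<open>\<open>coface n i : [n - 1] \<rightarrow> [n]\<close> is used for \<open>n \<ge> 1\<close> and \<open>i \<le> n\<close> only.\<close>

definition coface :: "nat \<Rightarrow> nat \<Rightarrow> nat \<Rightarrow> nat" where
  "coface n i = (\<lambda>v\<in>{..n - 1}. if v < i then v else v + 1)"

text \<open>\<open>codegen n i : [n + 1] \<rightarrow> [n]\<close>, for \<open>i \<le> n\<close>.\<close>

definition codegen :: "nat \<Rightarrow> nat \<Rightarrow> nat \<Rightarrow> nat" where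
  "codegen n i = (\<lambda>v\<in>{..n + 1}. if v \<le> i then v else v - 1)"

text \<open>The maps \<open>s\<^sub>k\<close> and \<open>t\<^sub>k\<close> from \<open>[k]\<close> to \<open>[n]\<close>, for \<open>k \<le> n\<close>.\<close>

definition source_incl :: "nat \<Rightarrow> nat \<Rightarrow> nat \<Rightarrow> nat" where
  "source_incl k n = (\<lambda>v\<in>{..k}. v)"

definition target_incl :: "nat \<Rightarrow> nat \<Rightarrow> nat \<Rightarrow> nat" where
  "target_incl k n = (\<lambda>v\<in>{..k}. v + n - k)"

text \<open>For \<open>f : [m] \<rightarrow> [n]\<close> and \<open>A \<in> C n\<close>, the element \<open>A f \<in> C m\<close> is \<open>act m n f A\<close>.\<close>

locale simplicial_set =
  fixes C :: "nat \<Rightarrow> 'a set"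
    and act :: "nat \<Rightarrow> nat \<Rightarrow> (nat \<Rightarrow> nat) \<Rightarrow> 'a \<Rightarrow> 'a"
  assumes act_closed: "f \<in> ord_maps m n \<Longrightarrow> A \<in> C n \<Longrightarrow> act m n f A \<in> C m"
    and act_id: "A \<in> C n \<Longrightarrow> act n n (\<lambda>v\<in>{..n}. v) A = A"
    and act_compose: "g \<in> ord_maps l m \<Longrightarrow> f \<in> ord_maps m n \<Longrightarrow> A \<in> C n \<Longrightarrow>
      act l m g (act m n f A) = act l n (compose {..l} f g) A"

definition composable ::
    "(nat \<Rightarrow> 'a set) \<Rightarrow> (nat \<Rightarrow> nat \<Rightarrow> (nat \<Rightarrow> nat) \<Rightarrow> 'a \<Rightarrow> 'a) \<Rightarrow>
     nat \<Rightarrow> nat \<Rightarrow> nat \<Rightarrow> 'a \<Rightarrow> 'a \<Rightarrow> bool" where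
  "composable C act k m n A B \<longleftrightarrow>
     k \<le> m \<and> k \<le> n \<and> A \<in> C m \<and> B \<in> C n \<and>
     act k m (target_incl k m) A = act k n (source_incl k n) B"

text \<open>
  \<open>cmp k m n A B\<close> is \<open>A \<circ>\<^sub>k B\<close> for \<open>A \<in> C m\<close> and \<open>B \<in> C n\<close>; its values are constrained on
  composable pairs only. In the back-and-forth laws the pairs on the left are again composable:
  the face and identity laws yield \<open>(A \<circ>\<^sub>k B) s\<^sub>m = A\<close> and \<open>(A \<circ>\<^sub>k B) t\<^sub>n = B\<close>. The index
  \<open>i - m + k\<close> is written \<open>i + k - m\<close>, which is not affected by truncation since \<open>m - k \<le> i\<close>
  wherever it is used.
\<close>

locale compository = simplicial_set C act
  for C :: "nat \<Rightarrow> 'a set"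
    and act :: "nat \<Rightarrow> nat \<Rightarrow> (nat \<Rightarrow> nat) \<Rightarrow> 'a \<Rightarrow> 'a" +
  fixes cmp :: "nat \<Rightarrow> nat \<Rightarrow> nat \<Rightarrow> 'a \<Rightarrow> 'a \<Rightarrow> 'a"
  assumes cmp_closed:
      "composable C act k m n A B \<Longrightarrow> cmp k m n A B \<in> C (m + n - k)"
    and identity_left:
      "A \<in> C m \<Longrightarrow> k \<le> m \<Longrightarrow> cmp k k m (act k m (source_incl k m) A) A = A"
    and identity_right:
      "A \<in> C m \<Longrightarrow> k \<le> m \<Longrightarrow> cmp k m k A (act k m (target_incl k m) A) = A"
    and forth_law:
      "composable C act k m n A B \<Longrightarrow> i \<le> n - k \<Longrightarrow>
        cmp (k + i) (m + i) n
          (act (m + i) (m + n - k) (source_incl (m + i) (m + n - k)) (cmp k m n A B)) B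
        = cmp k m n A B"
    and back_law:
      "composable C act k m n A B \<Longrightarrow> j \<le> m - k \<Longrightarrow>
        cmp (k + j) m (n + j) A
          (act (n + j) (m + n - k) (target_incl (n + j) (m + n - k)) (cmp k m n A B))
        = cmp k m n A B"
    and degeneracy_left:
      "composable C act k m n A B \<Longrightarrow> i \<le> m - k \<Longrightarrow>
        act (m + n - k + 1) (m + n - k) (codegen (m + n - k) i) (cmp k m n A B)
        = cmp k (m + 1) n (act (m + 1) m (codegen m i) A) B"
    and degeneracy_right:
      "composable C act k m n A B \<Longrightarrow> m \<le> i \<Longrightarrow> i \<le> m + n - k \<Longrightarrow>
        act (m + n - k + 1) (m + n - k) (codegen (m + n - k) i) (cmp k m n A B)
        = cmp k m (n + 1) A (act (n + 1) n (codegen n (i + k - m)) B)"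
    and degeneracy_middle:
      "composable C act k m n A B \<Longrightarrow> m - k \<le> i \<Longrightarrow> i \<le> m \<Longrightarrow>
        act (m + n - k + 1) (m + n - k) (codegen (m + n - k) i) (cmp k m n A B)
        = cmp (k + 1) (m + 1) (n + 1)
            (act (m + 1) m (codegen m i) A) (act (n + 1) n (codegen n (i + k - m)) B)"
    and face_left:
      "composable C act k m n A B \<Longrightarrow> i < m - k \<Longrightarrow>
        act (m + n - k - 1) (m + n - k) (coface (m + n - k) i) (cmp k m n A B)
        = cmp k (m - 1) n (act (m - 1) m (coface m i) A) B"
    and face_right:
      "composable C act k m n A B \<Longrightarrow> m < i \<Longrightarrow> i \<le> m + n - k \<Longrightarrow>
        act (m + n - k - 1) (m + n - k) (coface (m + n - k) i) (cmp k m n A B)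
        = cmp k m (n - 1) A (act (n - 1) n (coface n (i + k - m)) B)"

text \<open>
  Distinct points may have distance \<open>0\<close>, hence these are not instances of \<open>Metric_space\<close>.
\<close>

definition asym_metrics :: "nat \<Rightarrow> (nat \<times> nat \<Rightarrow> real) set" where
  "asym_metrics n = {d \<in> {..n} \<times> {..n} \<rightarrow>\<^sub>E {0..}.
     (\<forall>x\<le>n. d (x, x) = 0) \<and>
     (\<forall>x\<le>n. \<forall>y\<le>n. \<forall>z\<le>n. d (x, z) \<le> d (x, y) + d (y, z))}"

definition metrics :: "nat \<Rightarrow> (nat \<times> nat \<Rightarrow> real) set" where
  "metrics n = {d \<in> asym_metrics n. \<forall>x\<le>n. \<forall>y\<le>n. d (x, y) = d (y, x)}"

definition pullback ::
    "nat \<Rightarrow> nat \<Rightarrow> (nat \<Rightarrow> nat) \<Rightarrow> (nat \<times> nat \<Rightarrow> real) \<Rightarrow> nat \<times> nat \<Rightarrow> real" where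
  "pullback m n f A = (\<lambda>(x, y)\<in>{..m} \<times> {..m}. A (f x, f y))"

text \<open>On overlapping cases the first one is taken.\<close>

definition glue ::
    "nat \<Rightarrow> nat \<Rightarrow> nat \<Rightarrow> (nat \<times> nat \<Rightarrow> real) \<Rightarrow> (nat \<times> nat \<Rightarrow> real) \<Rightarrow>
     nat \<times> nat \<Rightarrow> real" where
  "glue k m n A B = (\<lambda>(x, z)\<in>{..m + n - k} \<times> {..m + n - k}.
     if x \<le> m \<and> z \<le> m then A (x, z)
     else if x \<le> m \<and> m - k \<le> z then
       (MIN y\<in>{m - k..m}. A (x, y) + B (y + k - m, z + k - m))
     else if m - k \<le> x \<and> z \<le> m then
       (MIN y\<in>{m - k..m}. B (x + k - m, y + k - m) + A (y, z))
     else B (x + k - m, z + k - m))"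

end

theory Submission
  imports Defs
begin

text \<open>
  Let \<open>N = m + n - k\<close>. Gluing \<open>A\<close> and \<open>B\<close> means viewing them as distances on the initial segment
  \<open>{0..m}\<close> and the final segment \<open>{m - k..N}\<close>, which agree on their intersection, the window
  \<open>{m - k..m}\<close>. The composite is determined by three properties: it is a metric, it restricts to \<open>A\<close>
  and to \<open>B\<close>, and every distance from one segment to the other is realized by a path with a stop in
  the window. Indeed the triangle inequality bounds such a distance by the minimum in the definition
  of \<open>glue\<close>, and the stop shows that the bound is attained
  (\<open>glue_restrictions_eq\<close>). Conversely the glued function has these properties; the only
  substantial point is its triangle inequality (\<open>triangle_on_union\<close>), which holds because a detour
  into the other segment enters and leaves through the window, where both distances agree.

  All laws then follow by checking the three properties. For the identity and back-and-forth laws, a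
  metric that factors through a window factors through every larger one, and a distance with an
  endpoint in the window factors trivially. The face and degeneracy laws are instances of one
  naturality statement (\<open>pullback_glue\<close>): a pulled back composite is the composite of the pulled back
  factors whenever the new window is mapped onto the old one.

  Symmetry enters only in the claim that the operations preserve it, so the laws are proved
  for \<open>asym_metrics\<close> and inherited by \<open>metrics\<close>.
\<close>

section \<open>Metrics on ordinals and their pullbacks\<close>

lemma asym_metricsD:
  assumes "d \<in> asym_metrics n"
  shows "x \<le> n \<Longrightarrow> y \<le> n \<Longrightarrow> 0 \<le> d (x, y)"
    and "x \<le> n \<Longrightarrow> d (x, x) = 0"
    and "x \<le> n \<Longrightarrow> y \<le> n \<Longrightarrow> z \<le> n \<Longrightarrow> d (x, z) \<le> d (x, y) + d (y, z)"
    and "\<not> (x \<le> n \<and> y \<le> n) \<Longrightarrow> d (x, y) = undefined"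
  using assms by (auto simp: asym_metrics_def PiE_iff extensional_def)

lemma asym_metrics_ext:
  assumes "d \<in> asym_metrics n" "e \<in> asym_metrics n"
    and "\<And>x y. x \<le> n \<Longrightarrow> y \<le> n \<Longrightarrow> d (x, y) = e (x, y)"
  shows "d = e"
  using asym_metricsD(4)[OF assms(1)] asym_metricsD(4)[OF assms(2)] assms(3)
  by (metis ext surj_pair)

lemma metrics_subset_asym_metrics: "metrics n \<subseteq> asym_metrics n"
  by (auto simp: metrics_def)

lemma pullback_apply [simp]:
  "pullback m n f A (x, y) = (if x \<le> m \<and> y \<le> m then A (f x, f y) else undefined)"
  by (auto simp: pullback_def)

lemma ord_maps_le: "f \<in> ord_maps m n \<Longrightarrow> v \<le> m \<Longrightarrow> f v \<le> n"
  by (auto simp: ord_maps_def)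

lemma pullback_asym_metrics:
  assumes "f \<in> ord_maps m n" "A \<in> asym_metrics n"
  shows "pullback m n f A \<in> asym_metrics m"
proof -
  have "pullback m n f A \<in> {..m} \<times> {..m} \<rightarrow>\<^sub>E {0..}"
    using asym_metricsD(1)[OF assms(2)] ord_maps_le[OF assms(1)]
    by (auto simp: PiE_iff extensional_def)
  then show ?thesis
    using asym_metricsD(2,3)[OF assms(2)] ord_maps_le[OF assms(1)]
    by (auto simp: asym_metrics_def)
qed

lemma pullback_metrics:
  assumes "f \<in> ord_maps m n" "A \<in> metrics n"
  shows "pullback m n f A \<in> metrics m"
  using pullback_asym_metrics[OF assms(1)] assms ord_maps_le[OF assms(1)]
  by (auto simp: metrics_def)

lemma pullback_id:
  assumes "A \<in> asym_metrics n"
  shows "pullback n n (\<lambda>v\<in>{..n}. v) A = A"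
proof (rule asym_metrics_ext[OF pullback_asym_metrics assms])
  show "(\<lambda>v\<in>{..n}. v) \<in> ord_maps n n"
    by (auto simp: ord_maps_def mono_on_def)
qed (use assms in auto)

lemma pullback_compose:
  assumes "g \<in> ord_maps l m"
  shows "pullback l m g (pullback m n f A) = pullback l n (compose {..l} f g) A"
  using ord_maps_le[OF assms] by (auto simp: compose_def fun_eq_iff)

lemma simplicial_set_metrics:
  assumes "M = metrics \<or> M = asym_metrics"
  shows "simplicial_set M pullback"
proof
  have M: "M n \<subseteq> asym_metrics n" for n
    using assms metrics_subset_asym_metrics by auto
  show "pullback m n f A \<in> M m" if "f \<in> ord_maps m n" "A \<in> M n" for f m n A
    using assms that pullback_metrics pullback_asym_metrics by auto
  show "pullback n n (\<lambda>v\<in>{..n}. v) A = A" if "A \<in> M n" for A n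
    using M that pullback_id by auto
  show "pullback l m g (pullback m n f A) = pullback l n (compose {..l} f g) A"
    if "g \<in> ord_maps l m" for g l m f n A
    using pullback_compose[OF that] .
qed

lemma source_incl_ord_maps: "k \<le> n \<Longrightarrow> source_incl k n \<in> ord_maps k n"
  by (auto simp: source_incl_def ord_maps_def mono_on_def)

lemma target_incl_ord_maps: "k \<le> n \<Longrightarrow> target_incl k n \<in> ord_maps k n"
  by (auto simp: target_incl_def ord_maps_def mono_on_def)

lemma coface_ord_maps: "0 < n \<Longrightarrow> coface n i \<in> ord_maps (n - 1) n"
  by (auto simp: coface_def ord_maps_def mono_on_def)

lemma codegen_ord_maps: "i \<le> n \<Longrightarrow> codegen n i \<in> ord_maps (n + 1) n"
  by (auto simp: codegen_def ord_maps_def mono_on_def)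

section \<open>Metrics that factor through a window\<close>

text \<open>
  The property that singles out the composite among all metrics extending its two factors. Both
  directions are required, since \<open>D\<close> may be asymmetric.
\<close>

definition factors_through :: "nat \<Rightarrow> nat \<Rightarrow> nat \<Rightarrow> (nat \<times> nat \<Rightarrow> real) \<Rightarrow> bool" where
  "factors_through N a b D \<longleftrightarrow>
     (\<forall>x\<le>b. \<forall>z. a \<le> z \<longrightarrow> z \<le> N \<longrightarrow>
        (\<exists>y\<in>{a..b}. D (x, z) = D (x, y) + D (y, z)) \<and>
        (\<exists>y\<in>{a..b}. D (z, x) = D (z, y) + D (y, x)))"

text \<open>
  For endpoints on either side of the larger window an old stop still serves; otherwise the stop is
  the endpoint inside it. This is what the back-and-forth laws need, since they compose along a
  larger overlap.
\<close>

lemma factors_through_enlarge: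
  assumes D: "D \<in> asym_metrics N" and fac: "factors_through N a b D"
    and "a' \<le> a" "a \<le> b" "b \<le> b'" "b' \<le> N"
  shows "factors_through N a' b' D"
  unfolding factors_through_def
proof (intro allI impI)
  fix x z assume xz: "x \<le> b'" "a' \<le> z" "z \<le> N"
  consider "a' \<le> x" | "z \<le> b'" | "x < a'" "b' < z" by linarith
  then show "(\<exists>y\<in>{a'..b'}. D (x, z) = D (x, y) + D (y, z)) \<and>
             (\<exists>y\<in>{a'..b'}. D (z, x) = D (z, y) + D (y, x))"
  proof cases
    case 1
    then show ?thesis using xz asym_metricsD(2)[OF D, of x] assms(6)
      by (intro conjI; intro bexI[of _ x]) auto
  next
    case 2
    then show ?thesis using xz asym_metricsD(2)[OF D, of z]
      by (intro conjI; intro bexI[of _ z]) auto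
  next
    case 3
    then have "x \<le> b" "a \<le> z" using assms by auto
    then obtain u v where "u \<in> {a..b}" "D (x, z) = D (x, u) + D (u, z)"
      and "v \<in> {a..b}" "D (z, x) = D (z, v) + D (v, x)"
      using fac xz unfolding factors_through_def by blast
    moreover have "{a..b} \<subseteq> {a'..b'}" using assms by auto
    ultimately show ?thesis by blast
  qed
qed

lemma factors_through_pullback:
  assumes fac: "factors_through N a b D"
    and f: "\<And>v. v \<le> N' \<Longrightarrow> f v \<le> N"
    and left: "\<And>v. v \<le> b' \<Longrightarrow> f v \<le> b" and right: "\<And>v. a' \<le> v \<Longrightarrow> v \<le> N' \<Longrightarrow> a \<le> f v"
    and onto: "{a..b} \<subseteq> f ` {a'..b'}" and "b' \<le> N'"
  shows "factors_through N' a' b' (pullback N' N f D)"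
  unfolding factors_through_def
proof (intro allI impI)
  fix x z assume xz: "x \<le> b'" "a' \<le> z" "z \<le> N'"
  then obtain u v where "u \<in> {a..b}" "D (f x, f z) = D (f x, u) + D (u, f z)"
    and "v \<in> {a..b}" "D (f z, f x) = D (f z, v) + D (v, f x)"
    using fac f left right unfolding factors_through_def by blast
  moreover from this obtain u' v' where
    "u' \<in> {a'..b'}" "u = f u'" "v' \<in> {a'..b'}" "v = f v'"
    using onto by blast
  ultimately show
    "(\<exists>y\<in>{a'..b'}. pullback N' N f D (x, z) = pullback N' N f D (x, y) + pullback N' N f D (y, z)) \<and>
     (\<exists>y\<in>{a'..b'}. pullback N' N f D (z, x) = pullback N' N f D (z, y) + pullback N' N f D (y, x))"
    using xz \<open>b' \<le> N'\<close>
    by - (rule conjI, rule bexI[of _ u'], force, force, rule bexI[of _ v'], force, force)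
qed

lemma MIN_eqI:
  fixes f :: "'b \<Rightarrow> 'c::linorder"
  assumes "finite S" "y \<in> S" "c = f y" "\<And>w. w \<in> S \<Longrightarrow> c \<le> f w"
  shows "(MIN w\<in>S. f w) = c"
  using assms by (intro Min_eqI) auto

lemma MIN_attained:
  fixes f :: "'b \<Rightarrow> 'c::linorder"
  assumes "finite S" "S \<noteq> {}"
  obtains y where "y \<in> S" "(MIN w\<in>S. f w) = f y"
proof -
  have "Min (f ` S) \<in> f ` S" using assms by (intro Min_in) auto
  then obtain y where "Min (f ` S) = f y" "y \<in> S" by (rule imageE)
  then show thesis by (intro that)
qed

text \<open>
  A metric that factors through the window is the composite of its two restrictions: by the
  triangle inequality no stop gives a shorter path, and some stop gives an equally long one.
\<close>

lemma glue_restrictions_eq: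
  assumes k: "k \<le> m" "k \<le> n" and N: "N = m + n - k"
    and D: "D \<in> asym_metrics N" and fac: "factors_through N (m - k) m D"
  shows "glue k m n (pullback m N (source_incl m N) D) (pullback n N (target_incl n N) D) = D"
    (is "glue k m n ?A ?B = D")
proof (rule ext, clarify)
  fix x z
  have A: "?A (u, v) = D (u, v)" if "u \<le> m" "v \<le> m" for u v
    using that by (simp add: source_incl_def)
  have B: "?B (u + k - m, v + k - m) = D (u, v)"
    if "m - k \<le> u" "u \<le> N" "m - k \<le> v" "v \<le> N" for u v
  proof -
    have "u + k - m \<le> n" "v + k - m \<le> n"
      and "u + k - m + N - n = u" "v + k - m + N - n = v"
      using that k N by auto
    then show ?thesis by (simp add: target_incl_def)
  qed
  have mN: "m \<le> N" using k N by auto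
  show "glue k m n ?A ?B (x, z) = D (x, z)"
  proof (cases "x \<le> N \<and> z \<le> N")
    case False
    then show ?thesis using asym_metricsD(4)[OF D False] N by (auto simp: glue_def)
  next
    case True
    consider "x \<le> m" "z \<le> m" | "x \<le> m" "m < z" | "m < x" "z \<le> m" | "m < x" "m < z"
      by linarith
    then show ?thesis
    proof cases
      case 1
      then show ?thesis using True A N by (simp add: glue_def)
    next
      case 2
      have "m - k \<le> z" using 2 by simp
      then obtain y where y: "y \<in> {m - k..m}" "D (x, z) = D (x, y) + D (y, z)"
        using fac 2 True unfolding factors_through_def by blast
      have "(MIN y\<in>{m - k..m}. ?A (x, y) + ?B (y + k - m, z + k - m)) =
            (MIN y\<in>{m - k..m}. D (x, y) + D (y, z))"
        using A B 2 True mN \<open>m - k \<le> z\<close>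
        by (intro arg_cong[where f = Min] image_cong refl) (simp del: pullback_apply)
      also have "\<dots> = D (x, z)"
      proof (rule MIN_eqI[of _ y])
        show "D (x, z) \<le> D (x, w) + D (w, z)" if "w \<in> {m - k..m}" for w
          using that asym_metricsD(3)[OF D] True mN by auto
      qed (use y in auto)
      finally show ?thesis using 2 True N \<open>m - k \<le> z\<close>
        by (simp add: glue_def del: pullback_apply)
    next
      case 3
      have "m - k \<le> x" using 3 by simp
      then obtain y where y: "y \<in> {m - k..m}" "D (x, z) = D (x, y) + D (y, z)"
        using fac 3 True unfolding factors_through_def by blast
      have "(MIN y\<in>{m - k..m}. ?B (x + k - m, y + k - m) + ?A (y, z)) =
            (MIN y\<in>{m - k..m}. D (x, y) + D (y, z))"
        using A B 3 True mN \<open>m - k \<le> x\<close>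
        by (intro arg_cong[where f = Min] image_cong refl) (simp del: pullback_apply)
      also have "\<dots> = D (x, z)"
      proof (rule MIN_eqI[of _ y])
        show "D (x, z) \<le> D (x, w) + D (w, z)" if "w \<in> {m - k..m}" for w
          using that asym_metricsD(3)[OF D] True mN by auto
      qed (use y in auto)
      finally show ?thesis using 3 True N \<open>m - k \<le> x\<close>
        by (simp add: glue_def del: pullback_apply)
    next
      case 4
      then show ?thesis using True N B[of x z] by (simp add: glue_def del: pullback_apply)
    qed
  qed
qed

text \<open>
  The hypotheses are symmetric in \<open>L\<close> and \<open>R\<close>, so the starting point may be taken in \<open>L\<close>. The
  only triangle that is not immediate then is a detour from \<open>L\<close> into \<open>R\<close> and back: it passes the
  intersection at some \<open>u\<close> and \<open>v\<close>, and the part between them may be cut short inside \<open>R\<close> and then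
  measured in \<open>L\<close>.
\<close>

lemma triangle_on_union:
  fixes G :: "'b \<Rightarrow> 'b \<Rightarrow> real"
  assumes L: "\<And>x y z. x \<in> L \<Longrightarrow> y \<in> L \<Longrightarrow> z \<in> L \<Longrightarrow> G x z \<le> G x y + G y z"
    and R: "\<And>x y z. x \<in> R \<Longrightarrow> y \<in> R \<Longrightarrow> z \<in> R \<Longrightarrow> G x z \<le> G x y + G y z"
    and LR: "\<And>x y z. x \<in> L \<Longrightarrow> y \<in> L \<inter> R \<Longrightarrow> z \<in> R \<Longrightarrow> G x z \<le> G x y + G y z"
    and RL: "\<And>x y z. x \<in> R \<Longrightarrow> y \<in> L \<inter> R \<Longrightarrow> z \<in> L \<Longrightarrow> G x z \<le> G x y + G y z"
    and LR_stop: "\<And>x z. x \<in> L \<Longrightarrow> z \<in> R \<Longrightarrow> \<exists>y\<in>L \<inter> R. G x z = G x y + G y z"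
    and RL_stop: "\<And>x z. x \<in> R \<Longrightarrow> z \<in> L \<Longrightarrow> \<exists>y\<in>L \<inter> R. G x z = G x y + G y z"
    and xyz: "x \<in> L \<union> R" "y \<in> L \<union> R" "z \<in> L \<union> R"
  shows "G x z \<le> G x y + G y z"
proof -
  have from_first: "G x z \<le> G x y + G y z"
    if x: "x \<in> P" and y: "y \<in> P \<union> Q" and z: "z \<in> P \<union> Q"
      and P: "\<And>x y z. x \<in> P \<Longrightarrow> y \<in> P \<Longrightarrow> z \<in> P \<Longrightarrow> G x z \<le> G x y + G y z"
      and Q: "\<And>x y z. x \<in> Q \<Longrightarrow> y \<in> Q \<Longrightarrow> z \<in> Q \<Longrightarrow> G x z \<le> G x y + G y z"
      and PQ: "\<And>x y z. x \<in> P \<Longrightarrow> y \<in> P \<inter> Q \<Longrightarrow> z \<in> Q \<Longrightarrow> G x z \<le> G x y + G y z"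
      and PQ_stop: "\<And>x z. x \<in> P \<Longrightarrow> z \<in> Q \<Longrightarrow> \<exists>y\<in>P \<inter> Q. G x z = G x y + G y z"
      and QP_stop: "\<And>x z. x \<in> Q \<Longrightarrow> z \<in> P \<Longrightarrow> \<exists>y\<in>P \<inter> Q. G x z = G x y + G y z"
    for P Q :: "'b set" and x y z
  proof -
    consider "y \<in> P" "z \<in> P" | "y \<in> Q" "z \<in> P" | "y \<in> P" "z \<in> Q" | "y \<in> Q" "z \<in> Q"
      using y z by blast
    then show ?thesis
    proof cases
      case 1
      then show ?thesis using P x by blast
    next
      case 2
      obtain u where u: "u \<in> P \<inter> Q" "G x y = G x u + G u y" using PQ_stop x 2 by blast
      obtain v where v: "v \<in> P \<inter> Q" "G y z = G y v + G v z" using QP_stop 2 by blast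
      have "G x z \<le> G x u + G u z" "G u z \<le> G u v + G v z" "G u v \<le> G u y + G y v"
        using P Q u v x 2 by auto
      then show ?thesis using u v by linarith
    next
      case 3
      obtain u where u: "u \<in> P \<inter> Q" "G y z = G y u + G u z" using PQ_stop 3 by blast
      have "G x z \<le> G x u + G u z" "G x u \<le> G x y + G y u"
        using P PQ u x 3 by auto
      then show ?thesis using u by linarith
    next
      case 4
      obtain u where u: "u \<in> P \<inter> Q" "G x y = G x u + G u y" using PQ_stop x 4 by blast
      have "G x z \<le> G x u + G u z" "G u z \<le> G u y + G y z"
        using Q PQ u x 4 by auto
      then show ?thesis using u by linarith
    qed
  qed
  show ?thesis
  proof (cases "x \<in> L")
    case True
    show ?thesis by (rule from_first[OF True xyz(2,3) L R LR LR_stop RL_stop])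
  next
    case False
    then have "x \<in> R" "y \<in> R \<union> L" "z \<in> R \<union> L" using xyz by auto
    note swapped = from_first[OF this, unfolded Int_commute[of R L]]
    show ?thesis by (rule swapped[OF R L RL RL_stop LR_stop])
  qed
qed

section \<open>The composite of two metrics\<close>

context
  fixes k m n :: nat and A B :: "nat \<times> nat \<Rightarrow> real"
  assumes comp: "composable asym_metrics pullback k m n A B"
begin

lemma k_le: "k \<le> m" "k \<le> n"
  and A_metric: "A \<in> asym_metrics m"
  and B_metric: "B \<in> asym_metrics n"
  using comp by (auto simp: composable_def)

lemma composable_overlap:
  assumes "m - k \<le> x" "x \<le> m" "m - k \<le> y" "y \<le> m"
  shows "B (x + k - m, y + k - m) = A (x, y)"
proof -
  have "pullback k m (target_incl k m) A (x + k - m, y + k - m) =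
        pullback k n (source_incl k n) B (x + k - m, y + k - m)"
    using comp by (simp add: composable_def)
  moreover have "x + k - m \<le> k" "y + k - m \<le> k"
    "x + k - m + m - k = x" "y + k - m + m - k = y"
    using assms k_le by auto
  ultimately show ?thesis by (simp add: target_incl_def source_incl_def)
qed

lemma shift_le: "m - k \<le> x \<Longrightarrow> x \<le> m + n - k \<Longrightarrow> x + k - m \<le> n"
  using k_le by auto

lemma glue_left:
  assumes "x \<le> m" "z \<le> m"
  shows "glue k m n A B (x, z) = A (x, z)"
proof -
  have "x \<le> m + n - k" "z \<le> m + n - k" using assms k_le by auto
  then show ?thesis using assms by (simp add: glue_def)
qed

text \<open>
  The four cases of the definition of \<open>glue\<close> agree on their overlaps: if an endpoint lies in the
  window, then a stop there costs nothing, and by the triangle inequality in \<open>A\<close> or \<open>B\<close> no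
  other stop is cheaper.
\<close>

lemma glue_left_right:
  assumes "x \<le> m" "m - k \<le> z" "z \<le> m + n - k"
  shows "glue k m n A B (x, z) = (MIN y\<in>{m - k..m}. A (x, y) + B (y + k - m, z + k - m))"
proof (cases "z \<le> m")
  case True
  have "(MIN y\<in>{m - k..m}. A (x, y) + B (y + k - m, z + k - m)) = A (x, z)"
    using True assms composable_overlap asym_metricsD(2,3)[OF A_metric]
    by (intro MIN_eqI[of _ z]) auto
  then show ?thesis using glue_left assms True by simp
next
  case False
  then show ?thesis using assms k_le by (simp add: glue_def)
qed

lemma glue_right_left:
  assumes "m - k \<le> x" "x \<le> m + n - k" "z \<le> m"
  shows "glue k m n A B (x, z) = (MIN y\<in>{m - k..m}. B (x + k - m, y + k - m) + A (y, z))"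
proof (cases "x \<le> m")
  case True
  have "(MIN y\<in>{m - k..m}. B (x + k - m, y + k - m) + A (y, z)) = A (x, z)"
    using True assms composable_overlap asym_metricsD(2,3)[OF A_metric]
    by (intro MIN_eqI[of _ x]) auto
  then show ?thesis using glue_left assms True by simp
next
  case False
  then show ?thesis using assms k_le by (simp add: glue_def)
qed

lemma glue_right:
  assumes "m - k \<le> x" "x \<le> m + n - k" "m - k \<le> z" "z \<le> m + n - k"
  shows "glue k m n A B (x, z) = B (x + k - m, z + k - m)"
proof -
  have tri: "B (x + k - m, z + k - m) \<le> B (x + k - m, y + k - m) + B (y + k - m, z + k - m)"
    if "y \<in> {m - k..m}" for y
  proof (rule asym_metricsD(3)[OF B_metric])
    show "y + k - m \<le> n" using that k_le by auto
  qed (use assms shift_le in auto)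
  consider "x \<le> m" | "z \<le> m" | "m < x" "m < z" by linarith
  then show ?thesis
  proof cases
    case 1
    have "(MIN y\<in>{m - k..m}. A (x, y) + B (y + k - m, z + k - m)) = B (x + k - m, z + k - m)"
    proof (rule MIN_eqI[of _ x])
      show "B (x + k - m, z + k - m) \<le> A (x, y) + B (y + k - m, z + k - m)"
        if "y \<in> {m - k..m}" for y
        using tri[OF that] composable_overlap[of x y] assms 1 that by auto
    qed (use 1 assms asym_metricsD(2)[OF A_metric] in auto)
    then show ?thesis using glue_left_right 1 assms by simp
  next
    case 2
    have "(MIN y\<in>{m - k..m}. B (x + k - m, y + k - m) + A (y, z)) = B (x + k - m, z + k - m)"
    proof (rule MIN_eqI[of _ z])
      show "B (x + k - m, z + k - m) \<le> B (x + k - m, y + k - m) + A (y, z)"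
        if "y \<in> {m - k..m}" for y
        using tri[OF that] composable_overlap[of y z] assms 2 that by auto
    qed (use 2 assms asym_metricsD(2)[OF A_metric] in auto)
    then show ?thesis using glue_right_left 2 assms by simp
  next
    case 3
    then show ?thesis using assms by (simp add: glue_def)
  qed
qed

lemma glue_left_right_le:
  assumes "x \<le> m" "y \<in> {m - k..m}" "m - k \<le> z" "z \<le> m + n - k"
  shows "glue k m n A B (x, z) \<le> glue k m n A B (x, y) + glue k m n A B (y, z)"
proof -
  have "glue k m n A B (x, z) \<le> A (x, y) + B (y + k - m, z + k - m)"
    unfolding glue_left_right[OF assms(1,3,4)] using assms(2) by (intro Min_le) auto
  moreover have "y \<le> m + n - k" using assms k_le by auto
  ultimately show ?thesis using assms by (simp add: glue_left glue_right)
qed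

lemma glue_right_left_le:
  assumes "m - k \<le> x" "x \<le> m + n - k" "y \<in> {m - k..m}" "z \<le> m"
  shows "glue k m n A B (x, z) \<le> glue k m n A B (x, y) + glue k m n A B (y, z)"
proof -
  have "glue k m n A B (x, z) \<le> B (x + k - m, y + k - m) + A (y, z)"
    unfolding glue_right_left[OF assms(1,2,4)] using assms(3) by (intro Min_le) auto
  moreover have "y \<le> m + n - k" using assms k_le by auto
  ultimately show ?thesis using assms by (simp add: glue_left glue_right)
qed

lemma factors_through_glue: "factors_through (m + n - k) (m - k) m (glue k m n A B)"
  unfolding factors_through_def
proof (intro allI impI conjI)
  fix x z assume xz: "x \<le> m" "m - k \<le> z" "z \<le> m + n - k"
  obtain y where y: "y \<in> {m - k..m}"
    "(MIN y\<in>{m - k..m}. A (x, y) + B (y + k - m, z + k - m)) = A (x, y) + B (y + k - m, z + k - m)"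
    by (rule MIN_attained[of "{m - k..m}" "\<lambda>y. A (x, y) + B (y + k - m, z + k - m)"]) auto
  moreover have "y \<le> m + n - k" using y k_le by auto
  ultimately have "glue k m n A B (x, z) = glue k m n A B (x, y) + glue k m n A B (y, z)"
    using xz glue_left_right[OF xz] by (simp add: glue_left glue_right)
  then show "\<exists>y\<in>{m - k..m}. glue k m n A B (x, z) = glue k m n A B (x, y) + glue k m n A B (y, z)"
    using y by blast
  obtain y where y: "y \<in> {m - k..m}"
    "(MIN y\<in>{m - k..m}. B (z + k - m, y + k - m) + A (y, x)) = B (z + k - m, y + k - m) + A (y, x)"
    by (rule MIN_attained[of "{m - k..m}" "\<lambda>y. B (z + k - m, y + k - m) + A (y, x)"]) auto
  moreover have "y \<le> m + n - k" using y k_le by auto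
  ultimately have "glue k m n A B (z, x) = glue k m n A B (z, y) + glue k m n A B (y, x)"
    using xz glue_right_left[OF xz(2,3,1)] by (simp add: glue_left glue_right)
  then show "\<exists>y\<in>{m - k..m}. glue k m n A B (z, x) = glue k m n A B (z, y) + glue k m n A B (y, x)"
    using y by blast
qed

text \<open>
  Membership rests on \<open>triangle_on_union\<close> for the two segments. A distance between them is
  nonnegative because it is a sum of one distance in each segment.
\<close>

lemma glue_asym_metrics: "glue k m n A B \<in> asym_metrics (m + n - k)"
proof -
  let ?G = "glue k m n A B" and ?N = "m + n - k"
  let ?L = "{..m}" and ?R = "{m - k..m + n - k}"
  have union: "{..?N} = ?L \<union> ?R" and inter: "?L \<inter> ?R = {m - k..m}"
    using k_le by auto
  have tri_L: "?G (x, z) \<le> ?G (x, y) + ?G (y, z)" if "x \<in> ?L" "y \<in> ?L" "z \<in> ?L" for x y z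
    using that asym_metricsD(3)[OF A_metric] by (simp add: glue_left)
  have tri_R: "?G (x, z) \<le> ?G (x, y) + ?G (y, z)" if "x \<in> ?R" "y \<in> ?R" "z \<in> ?R" for x y z
    using that shift_le asym_metricsD(3)[OF B_metric] by (simp add: glue_right)
  have LR_stop: "\<exists>y\<in>?L \<inter> ?R. ?G (x, z) = ?G (x, y) + ?G (y, z)"
    and RL_stop: "\<exists>y\<in>?L \<inter> ?R. ?G (z, x) = ?G (z, y) + ?G (y, x)"
    if "x \<in> ?L" "z \<in> ?R" for x z
    using factors_through_glue that unfolding factors_through_def inter by auto
  have tri: "?G (x, z) \<le> ?G (x, y) + ?G (y, z)" if "x \<le> ?N" "y \<le> ?N" "z \<le> ?N" for x y z
  proof -
    have "x \<in> ?L \<union> ?R" "y \<in> ?L \<union> ?R" "z \<in> ?L \<union> ?R" using that union by auto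
    from triangle_on_union[where G = "\<lambda>x y. ?G (x, y)", OF tri_L tri_R _ _ LR_stop RL_stop this]
    show ?thesis unfolding inter using glue_left_right_le glue_right_left_le by auto
  qed
  have nonneg_L: "0 \<le> ?G (x, z)" if "x \<in> ?L" "z \<in> ?L" for x z
    using that asym_metricsD(1)[OF A_metric] by (simp add: glue_left)
  have nonneg_R: "0 \<le> ?G (x, z)" if "x \<in> ?R" "z \<in> ?R" for x z
    using that shift_le asym_metricsD(1)[OF B_metric] by (simp add: glue_right)
  have nonneg_cross: "0 \<le> ?G (x, z) \<and> 0 \<le> ?G (z, x)" if "x \<in> ?L" "z \<in> ?R" for x z
    using LR_stop[OF that] RL_stop[OF that] nonneg_L nonneg_R that
    by (metis IntD1 IntD2 add_nonneg_nonneg)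
  have nonneg: "0 \<le> ?G (x, z)" if "x \<le> ?N" "z \<le> ?N" for x z
    using that nonneg_L nonneg_R nonneg_cross union by (metis UnE atMost_iff)
  have zero: "?G (x, x) = 0" if "x \<le> ?N" for x
  proof (cases "x \<le> m")
    case True
    then show ?thesis using asym_metricsD(2)[OF A_metric] by (simp add: glue_left)
  next
    case False
    then show ?thesis using that shift_le[of x] asym_metricsD(2)[OF B_metric]
      by (simp add: glue_right)
  qed
  have "?G \<in> {..?N} \<times> {..?N} \<rightarrow>\<^sub>E {0..}"
    using nonneg by (auto simp: PiE_iff glue_def)
  then show ?thesis using zero tri by (auto simp: asym_metrics_def)
qed

lemma pullback_source_glue:
  "pullback m (m + n - k) (source_incl m (m + n - k)) (glue k m n A B) = A"
proof (rule asym_metrics_ext[OF pullback_asym_metrics A_metric])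
  show "source_incl m (m + n - k) \<in> ord_maps m (m + n - k)"
    using k_le by (simp add: source_incl_ord_maps)
qed (use glue_asym_metrics in \<open>auto simp: source_incl_def glue_left\<close>)

lemma pullback_target_glue:
  "pullback n (m + n - k) (target_incl n (m + n - k)) (glue k m n A B) = B"
proof (rule asym_metrics_ext[OF pullback_asym_metrics B_metric])
  show "target_incl n (m + n - k) \<in> ord_maps n (m + n - k)"
    using k_le by (simp add: target_incl_ord_maps)
  fix x y assume xy: "x \<le> n" "y \<le> n"
  have "glue k m n A B (x + (m + n - k) - n, y + (m + n - k) - n) =
        B (x + (m + n - k) - n + k - m, y + (m + n - k) - n + k - m)"
    using xy k_le by (intro glue_right) auto
  then show "pullback n (m + n - k) (target_incl n (m + n - k)) (glue k m n A B) (x, y) = B (x, y)"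
    using xy k_le by (simp add: target_incl_def)
qed (use glue_asym_metrics in auto)

text \<open>
  Naturality of gluing. The map \<open>f\<close> restricts to \<open>g\<close> and \<open>h\<close> on the two segments; if it maps the
  window \<open>{m' - k'..m'}\<close> onto \<open>{m - k..m}\<close>, then stops lift along \<open>f\<close>, so the pullback factors
  through the new window. Cofaces and codegeneracies satisfy the hypotheses in the ranges of
  the face and degeneracy laws.
\<close>

lemma pullback_glue:
  assumes f: "f \<in> ord_maps N' (m + n - k)" and N': "N' = m' + n' - k'"
    and k': "k' \<le> m'" "k' \<le> n'"
    and g: "g \<in> ord_maps m' m" and fg: "\<And>v. v \<le> m' \<Longrightarrow> f v = g v"
    and h: "h \<in> ord_maps n' n" and fh: "\<And>v. v \<le> n' \<Longrightarrow> f (v + (m' - k')) = h v + (m - k)"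
    and onto: "{m - k..m} \<subseteq> f ` {m' - k'..m'}"
  shows "pullback N' (m + n - k) f (glue k m n A B) =
         glue k' m' n' (pullback m' m g A) (pullback n' n h B)"
proof -
  let ?N = "m + n - k" and ?G = "glue k m n A B"
  let ?D = "pullback N' ?N f ?G"
  have D: "?D \<in> asym_metrics N'"
    by (rule pullback_asym_metrics[OF f glue_asym_metrics])
  have f_ge: "m - k \<le> f v" if "m' - k' \<le> v" "v \<le> N'" for v
    using fh[of "v - (m' - k')"] that N' k' by auto
  have fac: "factors_through N' (m' - k') m' ?D"
  proof (rule factors_through_pullback[OF factors_through_glue])
    show "f v \<le> m" if "v \<le> m'" for v using fg ord_maps_le[OF g] that by simp
    show "m' \<le> N'" using N' k' by auto
  qed (use ord_maps_le[OF f] f_ge onto in auto)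
  have "pullback m' N' (source_incl m' N') ?D = pullback m' m g A"
    using fg ord_maps_le[OF g] N' k'
    by (auto simp: fun_eq_iff source_incl_def glue_left)
  moreover have "pullback n' N' (target_incl n' N') ?D = pullback n' n h B"
  proof (rule ext, clarify)
    fix x y
    have shift: "v + N' - n' = v + (m' - k')" for v using N' k' by simp
    have "?G (h x + (m - k), h y + (m - k)) = B (h x, h y)" if "x \<le> n'" "y \<le> n'"
    proof -
      have "h v + (m - k) \<le> ?N" "h v + (m - k) + k - m = h v" if "v \<le> n'" for v
        using ord_maps_le[OF h that] k_le by auto
      then show ?thesis
        using that glue_right[of "h x + (m - k)" "h y + (m - k)"] by simp
    qed
    then show "pullback n' N' (target_incl n' N') ?D (x, y) = pullback n' n h B (x, y)"
      using fh N' k' by (auto simp: target_incl_def shift)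
  qed
  ultimately show ?thesis
    using glue_restrictions_eq[OF k' N' D fac] by simp
qed

end

lemma glue_metrics:
  assumes comp: "composable metrics pullback k m n A B"
  shows "glue k m n A B \<in> metrics (m + n - k)"
proof -
  let ?G = "glue k m n A B"
  have comp': "composable asym_metrics pullback k m n A B"
    and A: "A \<in> metrics m" and B: "B \<in> metrics n" and k: "k \<le> m" "k \<le> n"
    using comp metrics_subset_asym_metrics by (auto simp: composable_def)
  have cross: "?G (x, z) = ?G (z, x)" if "x \<le> m" "m - k \<le> z" "z \<le> m + n - k" for x z
    unfolding glue_left_right[OF comp' that] glue_right_left[OF comp' that(2,3,1)]
    using A B that k
    by (intro arg_cong[where f = Min] image_cong refl) (auto simp: metrics_def)
  have "?G (x, z) = ?G (z, x)" if "x \<le> m + n - k" "z \<le> m + n - k" for x z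
  proof -
    consider "x \<le> m" "z \<le> m" | "x \<le> m" "m - k \<le> z" | "z \<le> m" "m - k \<le> x"
      | "m - k \<le> x" "m - k \<le> z" by linarith
    then show ?thesis
      using that A B cross glue_left[OF comp'] glue_right[OF comp'] shift_le[OF comp']
      by cases (auto simp: metrics_def)
  qed
  then show ?thesis using glue_asym_metrics[OF comp'] by (simp add: metrics_def)
qed

section \<open>The compository laws\<close>

lemma glue_identity_left:
  assumes A: "A \<in> asym_metrics m" and k: "k \<le> m"
  shows "glue k k m (pullback k m (source_incl k m) A) A = A"
proof -
  have "factors_through m 0 k A"
    unfolding factors_through_def
    using asym_metricsD(2)[OF A] k by (auto intro!: bexI)
  moreover have "pullback m m (target_incl m m) A = A"
    using pullback_id[OF A] by (simp add: target_incl_def)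
  ultimately show ?thesis
    using glue_restrictions_eq[of k k m m A] A k by simp
qed

lemma glue_identity_right:
  assumes A: "A \<in> asym_metrics m" and k: "k \<le> m"
  shows "glue k m k A (pullback k m (target_incl k m) A) = A"
proof -
  have "factors_through m (m - k) m A"
    unfolding factors_through_def
    using asym_metricsD(2)[OF A] by (auto intro!: bexI)
  moreover have "pullback m m (source_incl m m) A = A"
    using pullback_id[OF A] by (simp add: source_incl_def)
  ultimately show ?thesis
    using glue_restrictions_eq[of k m k m A] A k by simp
qed

lemma glue_forth:
  assumes comp: "composable asym_metrics pullback k m n A B" and i: "i \<le> n - k"
  shows "glue (k + i) (m + i) n
           (pullback (m + i) (m + n - k) (source_incl (m + i) (m + n - k)) (glue k m n A B)) B
         = glue k m n A B"
proof -
  note k = k_le[OF comp]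
  have "factors_through (m + n - k) (m + i - (k + i)) (m + i) (glue k m n A B)"
    using i k
    by (intro factors_through_enlarge[OF glue_asym_metrics[OF comp] factors_through_glue[OF comp]])
      auto
  then show ?thesis
    using glue_restrictions_eq[of "k + i" "m + i" n "m + n - k" "glue k m n A B"]
      glue_asym_metrics[OF comp] pullback_target_glue[OF comp] i k by simp
qed

lemma glue_back:
  assumes comp: "composable asym_metrics pullback k m n A B" and j: "j \<le> m - k"
  shows "glue (k + j) m (n + j) A
           (pullback (n + j) (m + n - k) (target_incl (n + j) (m + n - k)) (glue k m n A B))
         = glue k m n A B"
proof -
  note k = k_le[OF comp]
  have "factors_through (m + n - k) (m - (k + j)) m (glue k m n A B)"
    using j k
    by (intro factors_through_enlarge[OF glue_asym_metrics[OF comp] factors_through_glue[OF comp]])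
      auto
  then show ?thesis
    using glue_restrictions_eq[of "k + j" m "n + j" "m + n - k" "glue k m n A B"]
      glue_asym_metrics[OF comp] pullback_source_glue[OF comp] j k by simp
qed

text \<open>
  The new window has to be mapped onto the old one, and a codegeneracy doubles one point. If this
  point is at most the start of the old window, the window shifted by one will do; if it is at
  least the end, the window itself; if it lies in the window, the window enlarged by one point,
  which is why the middle law composes along \<open>k + 1\<close>.
\<close>

lemma glue_codegen_left:
  assumes comp: "composable asym_metrics pullback k m n A B" and i: "i \<le> m - k"
  shows "pullback (m + n - k + 1) (m + n - k) (codegen (m + n - k) i) (glue k m n A B)
         = glue k (m + 1) n (pullback (m + 1) m (codegen m i) A) B"
proof -
  note k = k_le[OF comp]
  have "pullback (m + n - k + 1) (m + n - k) (codegen (m + n - k) i) (glue k m n A B)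
        = glue k (m + 1) n (pullback (m + 1) m (codegen m i) A)
            (pullback n n (\<lambda>v\<in>{..n}. v) B)"
  proof (rule pullback_glue[OF comp])
    show "{m - k..m} \<subseteq> codegen (m + n - k) i ` {m + 1 - k..m + 1}"
    proof
      fix y assume "y \<in> {m - k..m}"
      then show "y \<in> codegen (m + n - k) i ` {m + 1 - k..m + 1}"
        using i k by (intro image_eqI[of _ _ "y + 1"]) (auto simp: codegen_def)
    qed
    show "codegen (m + n - k) i \<in> ord_maps (m + n - k + 1) (m + n - k)"
      using i k by (intro codegen_ord_maps) auto
    show "codegen m i \<in> ord_maps (m + 1) m"
      using i k by (intro codegen_ord_maps) auto
    show "(\<lambda>v\<in>{..n}. v) \<in> ord_maps n n"
      using source_incl_ord_maps[of n n] by (simp add: source_incl_def)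
  qed (use i k in \<open>auto simp: codegen_def\<close>)
  then show ?thesis using pullback_id[OF B_metric[OF comp]] by simp
qed

lemma glue_codegen_right:
  assumes comp: "composable asym_metrics pullback k m n A B" and i: "m \<le> i" "i \<le> m + n - k"
  shows "pullback (m + n - k + 1) (m + n - k) (codegen (m + n - k) i) (glue k m n A B)
         = glue k m (n + 1) A (pullback (n + 1) n (codegen n (i + k - m)) B)"
proof -
  note k = k_le[OF comp]
  have "pullback (m + n - k + 1) (m + n - k) (codegen (m + n - k) i) (glue k m n A B)
        = glue k m (n + 1)
            (pullback m m (\<lambda>v\<in>{..m}. v) A) (pullback (n + 1) n (codegen n (i + k - m)) B)"
  proof (rule pullback_glue[OF comp])
    show "{m - k..m} \<subseteq> codegen (m + n - k) i ` {m - k..m}"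
    proof
      fix y assume "y \<in> {m - k..m}"
      then show "y \<in> codegen (m + n - k) i ` {m - k..m}"
        using i k by (intro image_eqI[of _ _ y]) (auto simp: codegen_def)
    qed
    show "codegen (m + n - k) i \<in> ord_maps (m + n - k + 1) (m + n - k)"
      using i k by (intro codegen_ord_maps) auto
    show "(\<lambda>v\<in>{..m}. v) \<in> ord_maps m m"
      using source_incl_ord_maps[of m m] by (simp add: source_incl_def)
    show "codegen n (i + k - m) \<in> ord_maps (n + 1) n"
      using i k by (intro codegen_ord_maps) auto
  qed (use i k in \<open>auto simp: codegen_def\<close>)
  then show ?thesis using pullback_id[OF A_metric[OF comp]] by simp
qed

lemma glue_codegen_middle:
  assumes comp: "composable asym_metrics pullback k m n A B" and i: "m - k \<le> i" "i \<le> m"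
  shows "pullback (m + n - k + 1) (m + n - k) (codegen (m + n - k) i) (glue k m n A B)
         = glue (k + 1) (m + 1) (n + 1)
             (pullback (m + 1) m (codegen m i) A)
             (pullback (n + 1) n (codegen n (i + k - m)) B)"
proof -
  note k = k_le[OF comp]
  have "pullback (m + n - k + 1) (m + n - k) (codegen (m + n - k) i) (glue k m n A B)
        = glue (k + 1) (m + 1) (n + 1)
            (pullback (m + 1) m (codegen m i) A) (pullback (n + 1) n (codegen n (i + k - m)) B)"
  proof (rule pullback_glue[OF comp])
    show "{m - k..m} \<subseteq> codegen (m + n - k) i ` {m + 1 - (k + 1)..m + 1}"
    proof
      fix y assume "y \<in> {m - k..m}"
      then show "y \<in> codegen (m + n - k) i ` {m + 1 - (k + 1)..m + 1}"
        using i k by (intro image_eqI[of _ _ "if y \<le> i then y else y + 1"]) (auto simp: codegen_def)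
    qed
    show "codegen (m + n - k) i \<in> ord_maps (m + n - k + 1) (m + n - k)"
      using i k by (intro codegen_ord_maps) auto
    show "codegen m i \<in> ord_maps (m + 1) m"
      using i k by (intro codegen_ord_maps) auto
    show "codegen n (i + k - m) \<in> ord_maps (n + 1) n"
      using i k by (intro codegen_ord_maps) auto
  qed (use i k in \<open>auto simp: codegen_def\<close>)
  then show ?thesis .
qed

text \<open>
  A coface omitting a point outside the window maps the new window bijectively onto the old one.
  If a window point were omitted, stops there would be lost, and shortest paths could be too.
\<close>

lemma glue_coface_left:
  assumes comp: "composable asym_metrics pullback k m n A B" and i: "i < m - k"
  shows "pullback (m + n - k - 1) (m + n - k) (coface (m + n - k) i) (glue k m n A B)
         = glue k (m - 1) n (pullback (m - 1) m (coface m i) A) B"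
proof -
  note k = k_le[OF comp]
  have "pullback (m + n - k - 1) (m + n - k) (coface (m + n - k) i) (glue k m n A B)
        = glue k (m - 1) n (pullback (m - 1) m (coface m i) A)
            (pullback n n (\<lambda>v\<in>{..n}. v) B)"
  proof (rule pullback_glue[OF comp])
    show "{m - k..m} \<subseteq> coface (m + n - k) i ` {m - 1 - k..m - 1}"
    proof
      fix y assume "y \<in> {m - k..m}"
      then show "y \<in> coface (m + n - k) i ` {m - 1 - k..m - 1}"
        using i k by (intro image_eqI[of _ _ "y - 1"]) (auto simp: coface_def)
    qed
    show "coface (m + n - k) i \<in> ord_maps (m + n - k - 1) (m + n - k)"
      using i k by (intro coface_ord_maps) auto
    show "coface m i \<in> ord_maps (m - 1) m"
      using i k by (intro coface_ord_maps) auto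
    show "(\<lambda>v\<in>{..n}. v) \<in> ord_maps n n"
      using source_incl_ord_maps[of n n] by (simp add: source_incl_def)
  qed (use i k in \<open>auto simp: coface_def\<close>)
  then show ?thesis using pullback_id[OF B_metric[OF comp]] by simp
qed

lemma glue_coface_right:
  assumes comp: "composable asym_metrics pullback k m n A B" and i: "m < i" "i \<le> m + n - k"
  shows "pullback (m + n - k - 1) (m + n - k) (coface (m + n - k) i) (glue k m n A B)
         = glue k m (n - 1) A (pullback (n - 1) n (coface n (i + k - m)) B)"
proof -
  note k = k_le[OF comp]
  have "pullback (m + n - k - 1) (m + n - k) (coface (m + n - k) i) (glue k m n A B)
        = glue k m (n - 1)
            (pullback m m (\<lambda>v\<in>{..m}. v) A) (pullback (n - 1) n (coface n (i + k - m)) B)"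
  proof (rule pullback_glue[OF comp])
    show "{m - k..m} \<subseteq> coface (m + n - k) i ` {m - k..m}"
    proof
      fix y assume "y \<in> {m - k..m}"
      then show "y \<in> coface (m + n - k) i ` {m - k..m}"
        using i k by (intro image_eqI[of _ _ y]) (auto simp: coface_def)
    qed
    show "coface (m + n - k) i \<in> ord_maps (m + n - k - 1) (m + n - k)"
      using i k by (intro coface_ord_maps) auto
    show "(\<lambda>v\<in>{..m}. v) \<in> ord_maps m m"
      using source_incl_ord_maps[of m m] by (simp add: source_incl_def)
    show "coface n (i + k - m) \<in> ord_maps (n - 1) n"
      using i k by (intro coface_ord_maps) auto
  qed (use i k in \<open>auto simp: coface_def\<close>)
  then show ?thesis using pullback_id[OF A_metric[OF comp]] by simp
qed

theorem proposition3p3p3: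
  fixes M :: "nat \<Rightarrow> (nat \<times> nat \<Rightarrow> real) set"
  assumes "M = metrics \<or> M = asym_metrics"
  shows "(\<forall>k m n A B x z.
            composable M pullback k m n A B \<longrightarrow> x \<le> m + n - k \<longrightarrow> z \<le> m + n - k \<longrightarrow>
            (x \<le> m \<and> z \<le> m \<longrightarrow> glue k m n A B (x, z) = A (x, z)) \<and>
            (x \<le> m \<and> m - k \<le> z \<longrightarrow> glue k m n A B (x, z) =
               (MIN y\<in>{m - k..m}. A (x, y) + B (y + k - m, z + k - m))) \<and>
            (m - k \<le> x \<and> z \<le> m \<longrightarrow> glue k m n A B (x, z) =
               (MIN y\<in>{m - k..m}. B (x + k - m, y + k - m) + A (y, z))) \<and>
            (m - k \<le> x \<and> m - k \<le> z \<longrightarrow> glue k m n A B (x, z) =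
               B (x + k - m, z + k - m)))
         \<and> compository M pullback glue"
proof -
  have M: "A \<in> asym_metrics n" if "A \<in> M n" for A n
    using assms metrics_subset_asym_metrics that by auto
  have comp: "composable asym_metrics pullback k m n A B"
    if "composable M pullback k m n A B" for k m n A B
    using that M by (auto simp: composable_def)
  have closed: "glue k m n A B \<in> M (m + n - k)" if "composable M pullback k m n A B" for k m n A B
    using assms that glue_metrics glue_asym_metrics by auto
  interpret simplicial_set M pullback by (rule simplicial_set_metrics[OF assms])
  have "compository M pullback glue"
    by unfold_locales
      (fact closed
        glue_identity_left[OF M] glue_identity_right[OF M]
        glue_forth[OF comp] glue_back[OF comp]
        glue_codegen_left[OF comp] glue_codegen_right[OF comp] glue_codegen_middle[OF comp]
        glue_coface_left[OF comp] glue_coface_right[OF comp])+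
  then show ?thesis
    by (intro conjI allI impI)
      (auto intro: glue_left[OF comp] glue_left_right[OF comp]
        glue_right_left[OF comp] glue_right[OF comp])
qed

end
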